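(* Let $\mu$ be a probability measure on $E$, let $(F,d_F)$ be a metric space, and let $\psi:E\to F$ be a diffeomorphism. Then for every $t$, $$\alpha_\mu^\psi(t)=\alpha_{\psi_*\mu}^{\mathrm{id}}(t),$$ where $\mathrm{id}$ is the identity map of $F$.
   Context: Convention: $E$ and $F$ are measurable spaces, and the group $\mathrm{Diff}(E,F)$ of "diffeomorphisms" is the set of measurable bijections $E\to F$ with measurable inverse. When $F$ is a metric space it carries its Borel $\sigma$-algebra. The pushforward of $\mu$ under $\psi$ is $(\psi_*\mu)(B)=\mu(\psi^{-1}(B))$. For a probability measure $\mu$ on $E$ and a diffeomorphism $\psi:E\to F$ into a metric space $(F,d_F)$, the $\psi$-concentration function of $\mu$ is $$\alpha_\mu^\psi(t):=\sup\{1-\mu(A_t^\psi): A\subseteq E \text{ measurable},\ \mu(A)\ge \tfrac12\},$$ where $A_t^\psi=\{x\in E: d_F(\psi(x),\psi(A))<t\}$ is the $\psi$-enlargement of $A$ and $d_F(y,B)=\inf_{z\in B}d_F(y,z)$. Correspondingly, for a probability measure $\nu$ on $F$, $\alpha_\nu^{\mathrm{id}}(t)=\sup\{1-\nu(B_t): B\subseteq F\text{ measurable},\ \nu(B)\ge\frac12\}$ with $B_t=\{y\in F:d_F(y,B)<t\}$. *)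

theory Defs
  imports "HOL-Analysis.Analysis" "HOL-Probability.Probability_Measure"
begin

text \<open>
  ``Diffeomorphism'' here means an isomorphism of measurable spaces. Only the underlying
  measurable spaces of the two arguments matter, not the measures they carry.
\<close>

definition diffeomorphism :: "'a measure \<Rightarrow> 'b measure \<Rightarrow> ('a \<Rightarrow> 'b) \<Rightarrow> bool" where
  "diffeomorphism E F \<psi> \<longleftrightarrow>
     bij_betw \<psi> (space E) (space F) \<and>
     \<psi> \<in> measurable E F \<and>
     inv_into (space E) \<psi> \<in> measurable F E"

definition enlargement ::
    "'a measure \<Rightarrow> ('a \<Rightarrow> 'b::metric_space) \<Rightarrow> 'a set \<Rightarrow> real \<Rightarrow> 'a set" where
  "enlargement E \<psi> A t = {x \<in> space E. infdist (\<psi> x) (\<psi> ` A) < t}"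

text \<open>
  For a probability measure the set below is nonempty (take the whole space) and contained
  in the unit interval, so its real supremum is meaningful. Sets \<open>A\<close> of measure at least
  one half are nonempty, so the convention that \<^const>\<open>infdist\<close> to the empty set is \<open>0\<close>
  is immaterial. The concentration function of a measure on a metric space itself
  is the instance \<open>\<psi> = id\<close>.
\<close>

definition concentration_function ::
    "'a measure \<Rightarrow> ('a \<Rightarrow> 'b::metric_space) \<Rightarrow> real \<Rightarrow> real" where
  "concentration_function \<mu> \<psi> t =
     Sup {1 - measure \<mu> (enlargement \<mu> \<psi> A t) |A. A \<in> sets \<mu> \<and> measure \<mu> A \<ge> 1/2}"

end

theory Submission
  imports Defs
begin

text \<open>A diffeomorphism \<psi> transports the whole structure: A \<mapsto> \<psi>(A) is a
  bijection between the measurable sets of \<mu> and the Borel sets of F, and it carries \<mu> to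
  its pushforward \<nu>. The \<psi>-enlargement of A is by definition measured in F, so it is the
  preimage under \<psi> of the ordinary enlargement of \<psi>(A)
  (\<open>measure_enlargement_distr\<close>). Hence A and \<psi>(A) are admissible together and
  contribute the same value, and both suprema run over one and the same set of reals.\<close>

lemma diffeomorphism_image_sets:
  assumes "diffeomorphism E F \<psi>" and A: "A \<in> sets E"
  shows "\<psi> ` A \<in> sets F"
proof -
  have bij: "bij_betw \<psi> (space E) (space F)"
    and inv: "inv_into (space E) \<psi> \<in> measurable F E"
    using assms(1) by (auto simp: diffeomorphism_def)
  have "A \<subseteq> space E"
    using A by (rule sets.sets_into_space)
  \<comment> \<open>Rewriting the forward image as a preimage under the inverse map brings in the
    measurability of that inverse.\<close>
  have "\<psi> ` A = inv_into (space E) \<psi> -` A \<inter> space F"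
  proof (intro equalityI subsetI)
    fix y assume "y \<in> \<psi> ` A"
    then show "y \<in> inv_into (space E) \<psi> -` A \<inter> space F"
      using bij \<open>A \<subseteq> space E\<close> by (auto simp: bij_betw_def subset_iff)
  next
    fix y assume "y \<in> inv_into (space E) \<psi> -` A \<inter> space F"
    then show "y \<in> \<psi> ` A"
      using bij_betw_inv_into_right[OF bij, of y] by (metis IntE image_eqI vimageD)
  qed
  then show ?thesis
    using measurable_sets[OF inv A] by simp
qed

text \<open>The distance to any fixed set is continuous, so the strict sublevel set is open. This
  lets the pushforward formula be applied to enlargements.\<close>

lemma infdist_less_borel: "{y. infdist y B < t} \<in> sets borel"
  by (intro borel_open open_Collect_less continuous_intros)

text \<open>Both enlargements impose the same condition on \<psi>(x), namely its distance to
  \<psi>(A), so one is the preimage of the other; the pushforward formula does the rest.\<close>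

lemma measure_enlargement_distr:
  fixes \<psi> :: "'a \<Rightarrow> 'b::metric_space"
  assumes "\<psi> \<in> borel_measurable \<mu>"
  shows "measure (distr \<mu> borel \<psi>) (enlargement (distr \<mu> borel \<psi>) id (\<psi> ` A) t)
       = measure \<mu> (enlargement \<mu> \<psi> A t)"
proof -
  have "\<psi> -` {y. infdist y (\<psi> ` A) < t} \<inter> space \<mu> = enlargement \<mu> \<psi> A t"
    by (auto simp: enlargement_def)
  then show ?thesis
    using measure_distr[OF assms infdist_less_borel[of "\<psi> ` A" t]]
    by (simp add: enlargement_def)
qed

theorem proposition2p3:
  fixes \<mu> :: "'a measure" and \<psi> :: "'a \<Rightarrow> 'b::metric_space" and t :: real
  assumes "prob_space \<mu>"
    and "diffeomorphism \<mu> (borel :: 'b measure) \<psi>"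
  shows "concentration_function \<mu> \<psi> t
       = concentration_function (distr \<mu> borel \<psi>) (id :: 'b \<Rightarrow> 'b) t"
proof -
  let ?\<nu> = "distr \<mu> borel \<psi>"
  have bij: "bij_betw \<psi> (space \<mu>) UNIV" and meas: "\<psi> \<in> borel_measurable \<mu>"
    using assms(2) by (auto simp: diffeomorphism_def)
  have image: "\<psi> ` A \<in> sets ?\<nu> \<and> measure ?\<nu> (\<psi> ` A) = measure \<mu> A"
    if A: "A \<in> sets \<mu>" for A
  proof -
    have "\<psi> ` A \<in> sets borel"
      using diffeomorphism_image_sets[OF assms(2) A] .
    \<comment> \<open>Injectivity: pulling the image back adds no points to A, so the pushforward
      gives the image exactly the mass of A.\<close>
    moreover have "\<psi> -` (\<psi> ` A) \<inter> space \<mu> = A"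
      using bij sets.sets_into_space[OF A] by (auto simp: bij_betw_def inj_on_def)
    ultimately show ?thesis
      using measure_distr[OF meas] by simp
  qed
  have preimage: "\<exists>A \<in> sets \<mu>. B = \<psi> ` A" if B: "B \<in> sets ?\<nu>" for B
  proof
    show "\<psi> -` B \<inter> space \<mu> \<in> sets \<mu>"
      using B meas by (simp add: measurable_sets)
    \<comment> \<open>Surjectivity: every point of B is hit, so the image of the preimage of B is
      all of B.\<close>
    have "y \<in> \<psi> ` space \<mu>" for y
      using bij by (simp add: bij_betw_def)
    then show "B = \<psi> ` (\<psi> -` B \<inter> space \<mu>)"
      by fast
  qed
  \<comment> \<open>The sets under the two suprema are shown to coincide, by matching A with B =
    \<psi>(A) in both directions.\<close>
  have "{1 - measure \<mu> (enlargement \<mu> \<psi> A t) |A. A \<in> sets \<mu> \<and> measure \<mu> A \<ge> 1/2}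
      = {1 - measure ?\<nu> (enlargement ?\<nu> id B t) |B. B \<in> sets ?\<nu> \<and> measure ?\<nu> B \<ge> 1/2}"
    (is "?L = ?R")
  proof (intro equalityI subsetI)
    fix x assume "x \<in> ?L"
    then obtain A where "A \<in> sets \<mu>" "measure \<mu> A \<ge> 1/2"
      "x = 1 - measure \<mu> (enlargement \<mu> \<psi> A t)"
      by blast
    then show "x \<in> ?R"
      using image[of A] measure_enlargement_distr[OF meas, of A t]
      by (intro CollectI exI[of _ "\<psi> ` A"]) simp
  next
    fix x assume "x \<in> ?R"
    then obtain B where B: "B \<in> sets ?\<nu>" "measure ?\<nu> B \<ge> 1/2"
      "x = 1 - measure ?\<nu> (enlargement ?\<nu> id B t)"
      by blast
    from preimage[OF B(1)] obtain A where "A \<in> sets \<mu>" "B = \<psi> ` A"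
      by blast
    then show "x \<in> ?L"
      using B image[of A] measure_enlargement_distr[OF meas, of A t]
      by (intro CollectI exI[of _ A]) simp
  qed
  then show ?thesis
    by (simp only: concentration_function_def)
qed

end
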